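(* Let $G$ be a finite undirected graph on vertex set $\{1,\dots,n\}$ that is either a complete graph or a wheel, and let $(i,j)\in E(G)$. Then every optimal basic feasible solution $x^0$ of the linear program RELP$(i,j)$ on $G$ gives an optimal vertex cover of $G$, i.e. $x^0\in\{0,1\}^n$ and $\{k : x^0_k=1\}$ is a minimum-cardinality vertex cover of $G$.
   Context: A vertex cover of $G=(V,E)$ is a set of vertices meeting every edge. An odd cycle of $G$ is a cycle with $2s+1$ vertices for some integer $s\ge1$; let $\Omega$ be the set of all odd cycles of $G$, and for $\omega_k\in\Omega$ write $|\omega_k|=2s_k+1$. For an edge $(r,s)\in E$, RELP$(r,s)$ is the linear program: minimize $\sum_{v=1}^n x_v$ subject to $x_u+x_v\ge1$ for all $(u,v)\in E\setminus\{(r,s)\}$, $x_r+x_s=1$, $\sum_{v\in\omega_k}x_v\ge s_k+1$ for all $\omega_k\in\Omega$, and $x_v\ge0$ for all $v$. A wheel is the graph obtained from a cycle by adding one new vertex adjacent to every vertex of the cycle. *)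

theory Defs
  imports "HOL-Analysis.Analysis"
begin

text \<open>
  A graph on \<open>n = CARD('n)\<close> vertices has the finite type \<open>'n\<close> as its vertex set and is given
  by its set of edges, each of which is a two-element set of vertices.
\<close>

definition complete_graph :: "'n::finite set set \<Rightarrow> bool" where
  "complete_graph E \<longleftrightarrow> E = {{u, v} | u v. u \<noteq> v}"

definition cycle_edges :: "'n list \<Rightarrow> 'n set set" where
  "cycle_edges vs = {{vs ! k, vs ! (Suc k mod length vs)} | k. k < length vs}"

definition wheel_graph :: "'n::finite set set \<Rightarrow> bool" where
  "wheel_graph E \<longleftrightarrow>
     (\<exists>h vs. distinct vs \<and> 3 \<le> length vs \<and> h \<notin> set vs \<and> UNIV = insert h (set vs) \<and>
             E = cycle_edges vs \<union> {{h, v} | v. v \<in> set vs})"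

text \<open>
  A cycle is listed from one of its vertices in one of its two directions; different listings of
  the same cycle yield the same linear constraint.
\<close>

definition cycle_in :: "'n::finite set set \<Rightarrow> 'n list \<Rightarrow> bool" where
  "cycle_in E vs \<longleftrightarrow> distinct vs \<and> 3 \<le> length vs \<and> cycle_edges vs \<subseteq> E"

definition odd_cycles :: "'n::finite set set \<Rightarrow> 'n list set" where
  "odd_cycles E = {vs. cycle_in E vs \<and> (\<exists>s\<ge>1. length vs = 2 * s + 1)}"

definition vertex_cover :: "'n::finite set set \<Rightarrow> 'n set \<Rightarrow> bool" where
  "vertex_cover E C \<longleftrightarrow> (\<forall>e\<in>E. C \<inter> e \<noteq> {})"

definition minimum_vertex_cover :: "'n::finite set set \<Rightarrow> 'n set \<Rightarrow> bool" where
  "minimum_vertex_cover E C \<longleftrightarrow>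
     vertex_cover E C \<and> (\<forall>D. vertex_cover E D \<longrightarrow> card C \<le> card D)"

text \<open>
  Minimise \<open>objective \<bullet> x\<close> subject to \<open>a \<bullet> x \<ge> b\<close> for \<open>(a, b)\<close> in \<open>ge_constraints\<close> and
  \<open>a \<bullet> x = b\<close> for \<open>(a, b)\<close> in \<open>eq_constraints\<close>. Sign restrictions on the variables are
  ordinary inequality constraints, so they count as active constraints below.
\<close>

record 'n linear_program =
  objective :: "real ^ 'n"
  ge_constraints :: "((real ^ 'n) \<times> real) set"
  eq_constraints :: "((real ^ 'n) \<times> real) set"

definition feasible :: "'n::finite linear_program \<Rightarrow> real ^ 'n \<Rightarrow> bool" where
  "feasible P x \<longleftrightarrow>
     (\<forall>(a, b) \<in> ge_constraints P. a \<bullet> x \<ge> b) \<and> (\<forall>(a, b) \<in> eq_constraints P. a \<bullet> x = b)"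

definition optimal_solution :: "'n::finite linear_program \<Rightarrow> real ^ 'n \<Rightarrow> bool" where
  "optimal_solution P x \<longleftrightarrow>
     feasible P x \<and> (\<forall>y. feasible P y \<longrightarrow> objective P \<bullet> x \<le> objective P \<bullet> y)"

definition active_vectors :: "'n::finite linear_program \<Rightarrow> real ^ 'n \<Rightarrow> (real ^ 'n) set" where
  "active_vectors P x =
     {a. \<exists>b. (a, b) \<in> ge_constraints P \<union> eq_constraints P \<and> a \<bullet> x = b}"

text \<open>
  A basic feasible solution is a feasible point at which as many linearly independent constraints
  are active as there are variables.
\<close>

definition basic_feasible_solution :: "'n::finite linear_program \<Rightarrow> real ^ 'n \<Rightarrow> bool" where
  "basic_feasible_solution P x \<longleftrightarrow>
     feasible P x \<and> (\<exists>B \<subseteq> active_vectors P x. independent B \<and> card B = CARD('n))"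

definition RELP :: "'n::finite set set \<Rightarrow> 'n \<Rightarrow> 'n \<Rightarrow> 'n linear_program" where
  "RELP E r s =
     \<lparr> objective = (\<Sum>v\<in>UNIV. axis v 1),
       ge_constraints =
         {(axis u 1 + axis v 1, 1) | u v. {u, v} \<in> E - {{r, s}}} \<union>
         {(\<Sum>v\<in>set w. axis v 1, real t + 1) | w t. w \<in> odd_cycles E \<and> length w = 2 * t + 1} \<union>
         {(axis v 1, 0) | v. True},
       eq_constraints = {(axis r 1 + axis s 1, 1)} \<rparr>"

lemma objective_RELP: "objective (RELP E r s) \<bullet> x = (\<Sum>v\<in>UNIV. x $ v)"
  by (simp add: RELP_def inner_sum_left inner_axis')

lemma feasible_RELP_iff:
  "feasible (RELP E r s) x \<longleftrightarrow>
     (\<forall>u v. {u, v} \<in> E - {{r, s}} \<longrightarrow> x $ u + x $ v \<ge> 1) \<and>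
     x $ r + x $ s = 1 \<and>
     (\<forall>w\<in>odd_cycles E. \<forall>t. length w = 2 * t + 1 \<longrightarrow> (\<Sum>v\<in>set w. x $ v) \<ge> real t + 1) \<and>
     (\<forall>v. x $ v \<ge> 0)"
proof -
  have sum: "(\<Sum>v\<in>A. axis v 1) \<bullet> x = (\<Sum>v\<in>A. x $ v)" for A
    by (simp add: inner_sum_left inner_axis')
  have pair: "(axis u 1 + axis v 1) \<bullet> x = x $ u + x $ v" for u v
    by (simp add: inner_add_left inner_axis')
  have single: "axis v 1 \<bullet> x = x $ v" for v
    by (simp add: inner_axis')
  have ge: "(\<forall>(a, b) \<in> ge_constraints (RELP E r s). a \<bullet> x \<ge> b) \<longleftrightarrow>
     (\<forall>u v. {u, v} \<in> E - {{r, s}} \<longrightarrow> (axis u 1 + axis v 1) \<bullet> x \<ge> 1) \<and>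
     (\<forall>w\<in>odd_cycles E. \<forall>t. length w = 2 * t + 1 \<longrightarrow> (\<Sum>v\<in>set w. axis v 1) \<bullet> x \<ge> real t + 1) \<and>
     (\<forall>v. axis v 1 \<bullet> x \<ge> 0)"
    unfolding RELP_def linear_program.simps by blast
  have eq: "(\<forall>(a, b) \<in> eq_constraints (RELP E r s). a \<bullet> x = b) \<longleftrightarrow>
     (axis r 1 + axis s 1) \<bullet> x = 1"
    by (simp add: RELP_def)
  show ?thesis
    by (simp only: feasible_def ge eq sum pair single conj_ac)
qed

end

theory Submission imports Defs begin

text \<open>
  A basic feasible solution \<open>x\<close> is the only point satisfying all constraints that are active at
  \<open>x\<close>, so it is integral as soon as some 0/1 vector \<open>y\<close> satisfies them too.
  In a complete graph the triangles through \<open>i\<close> and \<open>j\<close> force \<open>x $ k = 1\<close> off \<open>{i, j}\<close>.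
  In a wheel with rim length \<open>m \<ge> 4\<close> (for \<open>m = 3\<close> it is complete), optimality against a vertex
  cover separating \<open>i\<close> from \<open>j\<close> forces hub value 1 and rim sum \<open>\<lceil>m/2\<rceil>\<close>; then \<open>y\<close> consists of
  the hub and every other rim vertex, starting at a suitably chosen place.
\<close>

section \<open>Basic feasible solutions and active constraints\<close>

text \<open>The independent active vectors are as many as the dimension, so they span the space. The
  vector \<open>y - x\<close> is orthogonal to each of them, hence to itself. The point
  \<open>y\<close> need not be feasible.\<close>

lemma basic_feasible_solution_unique:
  assumes "basic_feasible_solution P x"
    and tight: "\<And>a b. (a, b) \<in> ge_constraints P \<union> eq_constraints P \<Longrightarrow> a \<bullet> x = b \<Longrightarrow> a \<bullet> y = b"
  shows "y = x"
proof -
  obtain B where B: "B \<subseteq> active_vectors P x" "independent B" "card B = CARD('a)"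
    using assms(1) unfolding basic_feasible_solution_def by blast
  have "span B = UNIV"
    using card_ge_dim_independent[of B UNIV] B by auto
  moreover have "orthogonal (y - x) a" if "a \<in> B" for a
    using that B(1) tight
    by (force simp: active_vectors_def orthogonal_def inner_diff_left inner_diff_right inner_commute)
  ultimately have "orthogonal (y - x) (y - x)"
    using orthogonal_to_span[of "y - x" B "y - x"] by auto
  then show ?thesis
    by (simp add: orthogonal_self)
qed

text \<open>The hypothesis \<open>edge\<close> ranges over all of \<open>E\<close>, so with
  \<open>{r, s} \<in> E\<close> it also takes care of the equality constraint, which is just a tight
  edge.\<close>

lemma RELP_basic_feasible_solution_unique:
  fixes x y :: "real ^ 'n::finite"
  assumes "basic_feasible_solution (RELP E r s) x" and "{r, s} \<in> E"
    and edge: "\<And>u v. {u, v} \<in> E \<Longrightarrow> x $ u + x $ v = 1 \<Longrightarrow> y $ u + y $ v = 1"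
    and cycle: "\<And>w t. w \<in> odd_cycles E \<Longrightarrow> length w = 2 * t + 1 \<Longrightarrow>
      (\<Sum>v\<in>set w. x $ v) = real t + 1 \<Longrightarrow> (\<Sum>v\<in>set w. y $ v) = real t + 1"
    and zero: "\<And>v. x $ v = 0 \<Longrightarrow> y $ v = 0"
  shows "y = x"
proof (rule basic_feasible_solution_unique[OF assms(1)])
  fix a :: "real ^ 'n" and b
  assume "(a, b) \<in> ge_constraints (RELP E r s) \<union> eq_constraints (RELP E r s)" and ax: "a \<bullet> x = b"
  then consider
      u v where "{u, v} \<in> E" "a = axis u 1 + axis v 1" "b = 1"
    | w t where "w \<in> odd_cycles E" "length w = 2 * t + 1" "a = (\<Sum>v\<in>set w. axis v 1)" "b = real t + 1"
    | v where "a = axis v 1" "b = 0"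
    using assms(2) unfolding RELP_def linear_program.simps by blast
  then show "a \<bullet> y = b"
    using ax by cases (auto simp: inner_add_left inner_sum_left inner_axis' edge cycle zero)
qed

section \<open>Cycles and vertex covers\<close>

lemma cycle_edges_conv_image:
  "cycle_edges vs = (\<lambda>k. {vs ! k, vs ! (Suc k mod length vs)}) ` {..<length vs}"
  by (auto simp: cycle_edges_def)

lemma cycle_edges_rotate1: "cycle_edges (rotate1 vs) = cycle_edges vs"
proof (cases "vs = []")
  case False
  define n where "n = length vs"
  have n: "n > 0"
    using False by (simp add: n_def)
  have img: "(\<lambda>k. Suc k mod n) ` {..<n} = {..<n}"
  proof
    show "{..<n} \<subseteq> (\<lambda>k. Suc k mod n) ` {..<n}"
    proof
      fix k assume k: "k \<in> {..<n}"
      \<comment> \<open>The cyclic predecessor of \<open>k\<close> is the preimage; for 0 it wraps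
        around to \<open>n - 1\<close>.\<close>
      show "k \<in> (\<lambda>k. Suc k mod n) ` {..<n}"
        by (rule image_eqI[where x = "if k = 0 then n - 1 else k - 1"]) (use k n in auto)
    qed
  qed (use n in auto)
  have "cycle_edges (rotate1 vs) =
    (\<lambda>k. {vs ! (Suc k mod n), vs ! (Suc (Suc k mod n) mod n)}) ` {..<n}"
    unfolding cycle_edges_conv_image length_rotate1
    using n by (intro image_cong) (auto simp: nth_rotate1 n_def)
  also have "\<dots> = (\<lambda>k. {vs ! k, vs ! (Suc k mod n)}) ` (\<lambda>k. Suc k mod n) ` {..<n}"
    by (simp add: image_image)
  also have "\<dots> = cycle_edges vs"
    by (simp add: img[unfolded n_def] cycle_edges_conv_image n_def)
  finally show ?thesis .
qed simp

lemma cycle_edges_rotate: "cycle_edges (rotate k vs) = cycle_edges vs"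
  by (induction k) (simp_all add: cycle_edges_rotate1)

lemma sum_set_conv_nth: "distinct vs \<Longrightarrow> (\<Sum>v\<in>set vs. f v) = (\<Sum>k<length vs. f (vs ! k))"
  by (simp add: sum_list_distinct_conv_sum_set[symmetric] sum_list_sum_nth atLeast0LessThan)

text \<open>Each vertex lies on two edges of the cycle; the successor terms form the same sum, taken
  over the rotated list.\<close>

lemma sum_over_cycle_edges:
  fixes f :: "'a \<Rightarrow> real"
  assumes "distinct vs"
  shows "(\<Sum>k<length vs. f (vs ! k) + f (vs ! (Suc k mod length vs))) = 2 * (\<Sum>v\<in>set vs. f v)"
proof -
  have "(\<Sum>k<length vs. f (vs ! (Suc k mod length vs))) = (\<Sum>v\<in>set (rotate1 vs). f v)"
    using assms by (subst sum_set_conv_nth) (auto simp: nth_rotate1 intro!: sum.cong)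
  then show ?thesis
    using assms by (simp add: sum.distrib sum_set_conv_nth[symmetric])
qed

lemma cycle_sum_ge_half:
  fixes f :: "'a \<Rightarrow> real"
  assumes "distinct vs" and "\<And>u v. {u, v} \<in> cycle_edges vs \<Longrightarrow> f u + f v \<ge> 1"
  shows "2 * (\<Sum>v\<in>set vs. f v) \<ge> length vs"
proof -
  have "(\<Sum>k<length vs. 1) \<le> (\<Sum>k<length vs. f (vs ! k) + f (vs ! (Suc k mod length vs)))"
    by (rule sum_mono) (use assms(2) in \<open>force simp: cycle_edges_def\<close>)
  then show ?thesis
    using sum_over_cycle_edges[OF assms(1), of f] by simp
qed

lemma vertex_cover_Int_pair:
  assumes "vertex_cover E C" and "{u, v} \<in> E"
  shows "of_bool (u \<in> C) + of_bool (v \<in> C) \<ge> (1::real)"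
  using assms by (force simp: vertex_cover_def)

text \<open>The indicator of \<open>C\<close> satisfies the edge inequalities, so the cycle carries
  at least half its length. The count is an integer, which allows rounding up.\<close>

lemma vertex_cover_card_cycle:
  assumes "vertex_cover E C" "distinct vs" "cycle_edges vs \<subseteq> E"
  shows "(length vs + 1) div 2 \<le> card (C \<inter> set vs)"
proof -
  have "2 * (\<Sum>v\<in>set vs. of_bool (v \<in> C)) \<ge> real (length vs)"
    by (rule cycle_sum_ge_half) (use assms vertex_cover_Int_pair in \<open>fastforce+\<close>)
  moreover have "(\<Sum>v\<in>set vs. of_bool (v \<in> C)) = real (card (C \<inter> set vs))"
    by (simp add: of_bool_def sum.If_cases Int_commute Int_def)
  ultimately have "2 * card (C \<inter> set vs) \<ge> length vs"
    by linarith
  then show ?thesis by linarith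
qed

text \<open>Rounding up makes every cover satisfy the odd cycle constraints. The equality constraint
  demands that the cover contain exactly one of \<open>r\<close> and \<open>s\<close>.\<close>

lemma vertex_cover_feasible:
  fixes E :: "'n::finite set set"
  assumes "vertex_cover E C" and "r \<in> C \<longleftrightarrow> s \<notin> C"
  shows "feasible (RELP E r s) (\<chi> v. of_bool (v \<in> C))"
  unfolding feasible_RELP_iff
proof (intro conjI allI impI ballI)
  fix w t assume w: "w \<in> odd_cycles E" and t: "length w = 2 * t + 1"
  have "t + 1 \<le> card (C \<inter> set w)"
    using vertex_cover_card_cycle[OF assms(1), of w] w t by (auto simp: odd_cycles_def cycle_in_def)
  moreover have "(\<Sum>v\<in>set w. of_bool (v \<in> C)) = real (card (C \<inter> set w))"
    by (simp add: of_bool_def sum.If_cases Int_commute Int_def)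
  ultimately show "(\<Sum>v\<in>set w. (\<chi> v. of_bool (v \<in> C)) $ v) \<ge> real t + 1"
    by simp
next
  fix u v assume "{u, v} \<in> E - {{r, s}}"
  then show "(\<chi> v. of_bool (v \<in> C)) $ u + (\<chi> v. of_bool (v \<in> C)) $ v \<ge> (1::real)"
    using vertex_cover_Int_pair[OF assms(1)] by simp
qed (use assms(2) in auto)

lemma optimal_le_card_vertex_cover:
  fixes E :: "'n::finite set set"
  assumes "optimal_solution (RELP E r s) x" "vertex_cover E C" "r \<in> C \<longleftrightarrow> s \<notin> C"
  shows "(\<Sum>v\<in>UNIV. x $ v) \<le> card C"
proof -
  have "(\<Sum>v\<in>UNIV. x $ v) \<le> (\<Sum>v\<in>UNIV. of_bool (v \<in> C))"
    using assms(1) vertex_cover_feasible[OF assms(2,3)]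
    by (fastforce simp: optimal_solution_def objective_RELP)
  also have "\<dots> = card C"
    by (simp add: of_bool_def sum.If_cases)
  finally show ?thesis .
qed

lemma feasible_edge:
  assumes "feasible (RELP E r s) x" "{u, v} \<in> E"
  shows "x $ u + x $ v \<ge> 1"
  using assms unfolding feasible_RELP_iff
  by (cases "{u, v} = {r, s}") (auto simp: doubleton_eq_iff)

lemma triangle_constraint:
  assumes "feasible (RELP E r s) x" "distinct [u, v, w]" "{u, v} \<in> E" "{v, w} \<in> E" "{w, u} \<in> E"
  shows "x $ u + x $ v + x $ w \<ge> 2"
proof -
  have "cycle_edges [u, v, w] \<subseteq> E"
    using assms(3-5) by (simp add: cycle_edges_conv_image lessThan_Suc numeral_2_eq_2)
  moreover have "\<exists>s\<ge>1. length [u, v, w] = 2 * s + 1"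
    by (rule exI[of _ 1]) simp
  ultimately have "[u, v, w] \<in> odd_cycles E"
    unfolding odd_cycles_def cycle_in_def using assms(2) by simp
  moreover have "length [u, v, w] = 2 * 1 + 1"
    by simp
  ultimately have "(\<Sum>v\<in>set [u, v, w]. x $ v) \<ge> real 1 + 1"
    using assms(1) unfolding feasible_RELP_iff by blast
  then show ?thesis
    using assms(2) by simp
qed

text \<open>The last hypothesis speaks of all covers. Optimality alone would compare
  \<open>x\<close> only with covers that contain exactly one of \<open>r\<close> and
  \<open>s\<close>, since the others are not feasible.\<close>

lemma integral_feasible_minimum:
  fixes E :: "'n::finite set set"
  assumes "feasible (RELP E r s) x" and "\<And>k. x $ k \<in> {0, 1}"
    and "\<And>e. e \<in> E \<Longrightarrow> \<exists>u v. e = {u, v}"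
    and "\<And>D. vertex_cover E D \<Longrightarrow> (\<Sum>v\<in>UNIV. x $ v) \<le> card D"
  shows "minimum_vertex_cover E {k. x $ k = 1}"
proof -
  have x: "x $ v = of_bool (x $ v = 1)" for v
    using assms(2)[of v] by auto
  have "{k. x $ k = 1} \<inter> {u, v} \<noteq> {}" if "{u, v} \<in> E" for u v
    using feasible_edge[OF assms(1) that] assms(2)[of u] assms(2)[of v] by auto
  then have "vertex_cover E {k. x $ k = 1}"
    unfolding vertex_cover_def using assms(3) by metis
  moreover have "(\<Sum>v\<in>UNIV. x $ v) = card {k. x $ k = 1}"
    by (subst x) (simp add: of_bool_def sum.If_cases)
  ultimately show ?thesis
    using assms(4) unfolding minimum_vertex_cover_def by auto
qed

section \<open>Complete graphs\<close>

lemma complete_graph_edge_iff: "complete_graph E \<Longrightarrow> {u, v} \<in> E \<longleftrightarrow> u \<noteq> v"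
  by (auto simp: complete_graph_def doubleton_eq_iff)

text \<open>As \<open>x $ i + x $ j = 1\<close>, the triangle on \<open>i\<close>, \<open>j\<close>,
  \<open>k\<close> gives \<open>x $ k \<ge> 1\<close>, so the objective is at least
  \<open>CARD('n) - 1\<close>. The cover omitting \<open>j\<close> bounds it by the same number, and
  all slack vanishes.\<close>

lemma complete_graph_solution:
  fixes E :: "'n::finite set set"
  assumes K: "complete_graph E" and "i \<noteq> j" and opt: "optimal_solution (RELP E i j) x"
  shows "(\<Sum>v\<in>UNIV. x $ v) = real (CARD('n) - 1)" "\<And>k. k \<noteq> i \<Longrightarrow> k \<noteq> j \<Longrightarrow> x $ k = 1"
proof -
  note edge = complete_graph_edge_iff[OF K]
  have feas: "feasible (RELP E i j) x"
    using opt by (simp add: optimal_solution_def)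
  have ij: "x $ i + x $ j = 1"
    using feas by (simp add: feasible_RELP_iff)
  have ge: "x $ k \<ge> 1" if "k \<in> UNIV - {i, j}" for k
    using triangle_constraint[OF feas, of i j k] that \<open>i \<noteq> j\<close> ij by (auto simp: edge)
  have split: "(\<Sum>v\<in>UNIV. x $ v) = 1 + (\<Sum>v\<in>UNIV - {i, j}. x $ v)"
    using sum.subset_diff[of "{i, j}" UNIV "\<lambda>v. x $ v"] \<open>i \<noteq> j\<close> ij by simp
  have "card {i, j} \<le> CARD('n)"
    by (rule card_mono) auto
  then have n: "CARD('n) \<ge> 2"
    using \<open>i \<noteq> j\<close> by simp
  have "vertex_cover E (UNIV - {j})"
    using K by (auto simp: vertex_cover_def complete_graph_def)
  then have "(\<Sum>v\<in>UNIV. x $ v) \<le> card (UNIV - {j})"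
    using optimal_le_card_vertex_cover[OF opt] \<open>i \<noteq> j\<close> by blast
  then have le: "(\<Sum>v\<in>UNIV. x $ v) \<le> real (CARD('n) - 1)"
    by (simp add: card_Diff_subset)
  have "(\<Sum>v\<in>UNIV - {i, j}. x $ v - 1) = (\<Sum>v\<in>UNIV. x $ v) - real (CARD('n) - 1)"
    using n \<open>i \<noteq> j\<close> by (simp add: sum_subtractf split card_Diff_subset of_nat_diff)
  moreover have "(\<Sum>v\<in>UNIV - {i, j}. x $ v - 1) \<ge> 0"
    by (rule sum_nonneg) (use ge in force)
  ultimately have 0: "(\<Sum>v\<in>UNIV - {i, j}. x $ v - 1) = 0" "(\<Sum>v\<in>UNIV. x $ v) = real (CARD('n) - 1)"
    using le by auto
  then show "(\<Sum>v\<in>UNIV. x $ v) = real (CARD('n) - 1)" by simp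
  have "\<forall>k\<in>UNIV - {i, j}. x $ k - 1 = 0"
    by (subst sum_nonneg_eq_0_iff[symmetric]) (use ge 0 in auto)
  then show "x $ k = 1" if "k \<noteq> i" "k \<noteq> j" for k
    using that by auto
qed

text \<open>Two vertices outside a cover would span an uncovered edge.\<close>

lemma complete_graph_card_vertex_cover:
  fixes E :: "'n::finite set set"
  assumes "complete_graph E" "vertex_cover E D"
  shows "CARD('n) - 1 \<le> card D"
proof -
  have "u = v" if "u \<notin> D" "v \<notin> D" for u v
    using vertex_cover_Int_pair[OF assms(2), of u v] complete_graph_edge_iff[OF assms(1), of u v] that
    by auto
  then have "card (- D) \<le> 1"
    by (auto simp: card_le_Suc0_iff_eq)
  moreover have "card D + card (- D) = CARD('n)"
    using card_Un_disjoint[of D "- D"] by simp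
  ultimately show ?thesis by linarith
qed

lemma complete_graph_case:
  fixes E :: "'n::finite set set"
  assumes K: "complete_graph E" and "{i, j} \<in> E"
    and bfs: "basic_feasible_solution (RELP E i j) x" and opt: "optimal_solution (RELP E i j) x"
  shows "(\<forall>k. x $ k \<in> {0, 1}) \<and> minimum_vertex_cover E {k. x $ k = 1}"
proof -
  note edge = complete_graph_edge_iff[OF K]
  have ne: "i \<noteq> j"
    using assms(2) edge by blast
  note sol = complete_graph_solution[OF K ne opt]
  have feas: "feasible (RELP E i j) x"
    using opt by (simp add: optimal_solution_def)
  have ij: "x $ i + x $ j = 1" and nonneg: "\<And>v. x $ v \<ge> 0"
    using feas by (auto simp: feasible_RELP_iff)
  have "x $ i = 0 \<or> x $ j = 0"
  proof (rule ccontr)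
    assume "\<not> ?thesis"
    then have pos: "x $ v > 0" for v
      using sol(2)[of v] nonneg[of v] by (cases "v = i \<or> v = j") auto
    \<comment> \<open>Moving one unit from \<open>j\<close> to \<open>i\<close> keeps every active
      constraint tight while all values are positive. The point \<open>y\<close> is negative at
      \<open>j\<close>, but uniqueness tests only the constraints active at
      \<open>x\<close>.\<close>
    define y where "y = x + axis i 1 - axis j 1"
    have y: "y $ v = x $ v + of_bool (v = i) - of_bool (v = j)" for v
      by (simp add: y_def axis_def)
    have "y = x"
    proof (rule RELP_basic_feasible_solution_unique[OF bfs assms(2)])
      fix u v assume uv: "{u, v} \<in> E" and tight: "x $ u + x $ v = 1"
      \<comment> \<open>An endpoint outside \<open>{i, j}\<close> has value 1 already, so the
        positive value at the other end would give the edge slack.\<close>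
      have "u = i \<or> u = j" "v = i \<or> v = j"
        using sol(2)[of u] sol(2)[of v] pos[of u] pos[of v] tight by fastforce+
      then show "y $ u + y $ v = 1"
        using uv ij edge ne by (auto simp: y)
    next
      fix w t assume w: "w \<in> odd_cycles E" and t: "length w = 2 * t + 1"
        and tight: "(\<Sum>v\<in>set w. x $ v) = real t + 1"
      have "distinct w" and t1: "t \<ge> 1"
        using w t by (auto simp: odd_cycles_def cycle_in_def)
      then have card: "card (set w) = 2 * t + 1"
        using t by (simp add: distinct_card)
      \<comment> \<open>A cycle through only one of the two, say \<open>a\<close>, has sum
        \<open>x $ a + 2 * t\<close>, which exceeds \<open>t + 1\<close>. A cycle through both or
        neither has the same sum under \<open>y\<close>.\<close>
      have "i \<in> set w \<longleftrightarrow> j \<in> set w"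
      proof (rule ccontr)
        assume "(i \<in> set w) \<noteq> (j \<in> set w)"
        then obtain a b where ab: "{a, b} = {i, j}" "a \<in> set w" "b \<notin> set w"
          by blast
        have "(\<Sum>v\<in>set w. x $ v) = x $ a + (\<Sum>v\<in>set w - {a}. x $ v)"
          using ab(2) by (simp add: sum.remove)
        also have "(\<Sum>v\<in>set w - {a}. x $ v) = (\<Sum>v\<in>set w - {a}. 1)"
        proof (rule sum.cong)
          fix v assume "v \<in> set w - {a}"
          then have "v \<notin> {i, j}"
            using ab by blast
          then show "x $ v = 1"
            using sol(2) by simp
        qed simp
        also have "\<dots> = 2 * t"
          using ab(2) card by simp
        finally show False
          using tight pos[of a] t1 by simp
      qed
      then show "(\<Sum>v\<in>set w. y $ v) = real t + 1"
        using tight by (auto simp: y sum.distrib sum_subtractf of_bool_def)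
    next
      show "y $ v = 0" if "x $ v = 0" for v
        using that pos[of v] by simp
    qed
    then show False
      using y[of i] ne by simp
  qed
  then have int: "x $ k \<in> {0, 1}" for k
    using sol(2)[of k] ij by fastforce
  have "minimum_vertex_cover E {k. x $ k = 1}"
    using feas int
  proof (rule integral_feasible_minimum)
    show "\<exists>u v. e = {u, v}" if "e \<in> E" for e
      using that K by (auto simp: complete_graph_def)
    show "(\<Sum>v\<in>UNIV. x $ v) \<le> card D" if "vertex_cover E D" for D
      using complete_graph_card_vertex_cover[OF K that] sol(1) by simp
  qed
  then show ?thesis
    using int by blast
qed

section \<open>Wheels\<close>

text \<open>If the two pairs agreed crosswise, \<open>k\<close> and \<open>l\<close> would be cyclic
  successors of each other, which is impossible from length 3 on.\<close>

lemma cycle_edge_index_unique: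
  assumes "distinct vs" "3 \<le> length vs" "k < length vs" "l < length vs"
    and "{vs ! k, vs ! (Suc k mod length vs)} = {vs ! l, vs ! (Suc l mod length vs)}"
  shows "k = l"
proof -
  have "Suc k mod length vs < length vs" "Suc l mod length vs < length vs"
    using assms(2) by (intro mod_less_divisor; linarith)+
  then have "k = l \<or> k = Suc l mod length vs \<and> Suc k mod length vs = l"
    using assms by (auto simp: doubleton_eq_iff nth_eq_iff_index_eq)
  then show ?thesis
    using assms(2-4) by (auto simp: mod_Suc split: if_splits)
qed

section \<open>Sums along paths and odd cycles\<close>

lemma sum_consecutive_ge:
  fixes f :: "nat \<Rightarrow> real"
  assumes "\<And>l. l < a + 2 * t \<Longrightarrow> Suc l < a + 2 * t \<Longrightarrow> f l + f (Suc l) \<ge> 1"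
  shows "(\<Sum>l=a..<a + 2 * t. f l) \<ge> t"
  using assms
proof (induction t)
  case (Suc t)
  have "(\<Sum>l=a..<a + 2 * t. f l) \<ge> t"
    by (rule Suc.IH) (rule Suc.prems, auto)
  moreover have "f (a + 2 * t) + f (Suc (a + 2 * t)) \<ge> 1"
    by (rule Suc.prems) auto
  ultimately show ?case by simp
qed simp

text \<open>With the slack e(l) = f(l) + f(l+1) - 1, the difference f(l+2) - f(l) equals e(l+1) -
  e(l). So f changes over an even distance by an alternating sum of nonnegative slacks.\<close>

lemma alternating_bound:
  fixes f :: "nat \<Rightarrow> real"
  assumes "\<And>l. l < a + 2 * t \<Longrightarrow> f l + f (Suc l) \<ge> 1"
  shows "\<bar>f (a + 2 * t) - f a\<bar> \<le> (\<Sum>l=a..<a + 2 * t. f l + f (Suc l) - 1)"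
  using assms
proof (induction t)
  case (Suc t)
  have "\<bar>f (a + 2 * t) - f a\<bar> \<le> (\<Sum>l=a..<a + 2 * t. f l + f (Suc l) - 1)"
    by (rule Suc.IH) (rule Suc.prems, auto)
  moreover have "f (a + 2 * t) + f (Suc (a + 2 * t)) \<ge> 1"
      "f (Suc (a + 2 * t)) + f (Suc (Suc (a + 2 * t))) \<ge> 1"
    by (rule Suc.prems; simp)+
  ultimately show ?case by (simp add: abs_le_iff)
qed simp

lemma sum_odd_conv_pairs:
  fixes g :: "nat \<Rightarrow> real"
  shows "(\<Sum>k<2 * t + 1. g k) = g 0 + (\<Sum>l<t. g (2 * l + 1) + g (2 * l + 2))"
  by (induction t) auto

text \<open>
  Removing a vertex of value 1 from an odd cycle leaves a path with a perfect matching. The cycle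
  constraint is then a sum of edge constraints, so it is tight only if the matching edges are.
\<close>

lemma odd_cycle_tight_transfer:
  fixes f g :: "'n::finite \<Rightarrow> real"
  assumes "w \<in> odd_cycles E" "length w = 2 * t + 1" "c \<in> set w" "f c = 1" "g c = 1"
    and edge: "\<And>u v. {u, v} \<in> E \<Longrightarrow> f u + f v \<ge> 1"
      "\<And>u v. {u, v} \<in> E \<Longrightarrow> f u + f v = 1 \<Longrightarrow> g u + g v = 1"
    and tight: "(\<Sum>v\<in>set w. f v) = real t + 1"
  shows "(\<Sum>v\<in>set w. g v) = real t + 1"
proof -
  obtain k where k: "k < length w" "w ! k = c"
    using assms(3) by (auto simp: in_set_conv_nth)
  \<comment> \<open>Once \<open>c\<close> sits at index 0, the matching consists of the pairs at
    indices \<open>2 * l + 1\<close> and \<open>2 * l + 2\<close>.\<close>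
  define q where "q = rotate k w"
  have q: "distinct q" "length q = 2 * t + 1" "set q = set w" "cycle_edges q \<subseteq> E" "q ! 0 = c"
    using assms(1,2) k by (auto simp: q_def odd_cycles_def cycle_in_def cycle_edges_rotate nth_rotate)
  have sum: "(\<Sum>v\<in>set w. F v) = F c + (\<Sum>l<t. F (q ! (2 * l + 1)) + F (q ! (2 * l + 2)))"
    for F :: "'n \<Rightarrow> real"
    using sum_set_conv_nth[OF q(1), of F] sum_odd_conv_pairs[of "\<lambda>k. F (q ! k)" t] q by simp
  have pair: "{q ! (2 * l + 1), q ! (2 * l + 2)} \<in> E" if "l < t" for l
  proof -
    have "{q ! (2 * l + 1), q ! (Suc (2 * l + 1) mod length q)} \<in> cycle_edges q"
      using that q(2) unfolding cycle_edges_def by fastforce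
    then show ?thesis
      using that q by auto
  qed
  have "(\<Sum>l<t. f (q ! (2 * l + 1)) + f (q ! (2 * l + 2)) - 1) = 0"
    using tight sum[of f] assms(4) by (simp add: sum_subtractf)
  then have "\<forall>l\<in>{..<t}. f (q ! (2 * l + 1)) + f (q ! (2 * l + 2)) - 1 = 0"
    by (subst (asm) sum_nonneg_eq_0_iff) (use edge(1)[OF pair] in force)+
  then have "(\<Sum>l<t. g (q ! (2 * l + 1)) + g (q ! (2 * l + 2))) = (\<Sum>l<t. 1)"
    by (intro sum.cong refl edge(2) pair) auto
  then show ?thesis
    using sum[of g] assms(5) by simp
qed

section \<open>The structure of a wheel\<close>

locale wheel =
  fixes h :: "'n::finite" and p :: "'n list" and E :: "'n set set"
  assumes distinct_rim: "distinct p" and length_rim: "3 \<le> length p" and hub: "h \<notin> set p"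
    and vertices: "UNIV = insert h (set p)"
    and edges: "E = cycle_edges p \<union> {{h, v} | v. v \<in> set p}"
begin

abbreviation "m \<equiv> length p"

lemma rim_nonempty [simp]: "p \<noteq> []"
  using length_rim by auto

text \<open>This allows the locale to be interpreted again with the rim listed from any convenient
  starting vertex.\<close>

lemma wheel_rotate: "wheel h (rotate k p) E"
  using distinct_rim length_rim hub vertices edges
  by unfold_locales (simp_all add: cycle_edges_rotate)

lemma spoke: "v \<in> set p \<Longrightarrow> {h, v} \<in> E"
  by (auto simp: edges)

lemma rim_edge: "k < m \<Longrightarrow> {p ! k, p ! (Suc k mod m)} \<in> E"
  by (auto simp: edges cycle_edges_def)

lemma rim_edge_Suc: "Suc k < m \<Longrightarrow> {p ! k, p ! Suc k} \<in> E"
  using rim_edge[of k] by simp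

lemma edge_cases:
  assumes "{u, v} \<in> E"
  obtains (rim) k where "k < m" "{u, v} = {p ! k, p ! (Suc k mod m)}"
    | (spoke) w where "w \<in> set p" "{u, v} = {h, w}"
  using assms by (auto simp: edges cycle_edges_def)

lemma edge_pair: "e \<in> E \<Longrightarrow> \<exists>u v. e = {u, v}"
  by (auto simp: edges cycle_edges_def)

lemma rim_nth: "k < m \<Longrightarrow> p ! k \<in> set p \<and> p ! k \<noteq> h"
  using hub nth_mem by metis

lemma sum_vertices:
  fixes f :: "'n \<Rightarrow> real"
  shows "(\<Sum>v\<in>UNIV. f v) = f h + (\<Sum>v\<in>set p. f v)"
  by (subst vertices) (simp add: hub)

lemma wheel_triangle:
  assumes "feasible (RELP E r s) x" "Suc k < m"
  shows "x $ h + x $ (p ! k) + x $ (p ! Suc k) \<ge> 2"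
proof (rule triangle_constraint[OF assms(1)])
  have "p ! k \<noteq> p ! Suc k"
    using distinct_rim assms(2) by (simp add: nth_eq_iff_index_eq)
  then show "distinct [h, p ! k, p ! Suc k]"
    using rim_nth[of k] rim_nth[of "Suc k"] assms(2) by auto
  show "{h, p ! k} \<in> E" "{p ! k, p ! Suc k} \<in> E" "{p ! Suc k, h} \<in> E"
    using assms(2) spoke[of "p ! k"] spoke[of "p ! Suc k"] rim_edge_Suc
    by (auto simp: insert_commute)
qed

section \<open>The alternating cover and the size of covers\<close>

definition alternating_cover :: "'n set" where
  "alternating_cover = insert h ((!) p ` {k. k < m \<and> even k})"

lemma hub_in_alternating_cover: "h \<in> alternating_cover"
  by (simp add: alternating_cover_def)

lemma nth_in_alternating_cover: "k < m \<Longrightarrow> p ! k \<in> alternating_cover \<longleftrightarrow> even k"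
  using distinct_rim rim_nth by (auto simp: alternating_cover_def nth_eq_iff_index_eq)

text \<open>Neighbouring indices differ in parity, and the wrap-around edge is covered because it
  contains index 0. If the rim is odd, both ends of that edge are chosen.\<close>

lemma vertex_cover_alternating: "vertex_cover E alternating_cover"
  unfolding vertex_cover_def
proof
  fix e assume "e \<in> E"
  then obtain u v where e: "e = {u, v}" "{u, v} \<in> E"
    using edge_pair by blast
  from e(2) have "alternating_cover \<inter> {u, v} \<noteq> {}"
  proof (cases rule: edge_cases)
    case (rim k)
    have "p ! k \<in> alternating_cover \<or> p ! (Suc k mod m) \<in> alternating_cover"
      using rim(1) nth_in_alternating_cover[of k] nth_in_alternating_cover[of "Suc k mod m"]
      by (cases "Suc k = m") auto
    then show ?thesis
      using rim(2) by auto
  next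
    case spoke
    then show ?thesis
      using hub_in_alternating_cover by auto
  qed
  then show "alternating_cover \<inter> e \<noteq> {}"
    using e by simp
qed

lemma card_alternating_cover: "card alternating_cover = (m + 1) div 2 + 1"
proof -
  have "{k. k < m \<and> even k} = (\<lambda>j. 2 * j) ` {..<(m + 1) div 2}"
    by (auto elim!: evenE)
  then have "card {k. k < m \<and> even k} = (m + 1) div 2"
    by (simp add: card_image inj_on_def)
  moreover have "inj_on ((!) p) {k. k < m \<and> even k}"
    using distinct_rim by (auto simp: inj_on_def nth_eq_iff_index_eq)
  moreover have "h \<notin> (!) p ` {k. k < m \<and> even k}"
    using rim_nth by auto
  ultimately show ?thesis
    by (simp add: alternating_cover_def card_image)
qed

text \<open>A cover with the hub still has to cover the rim cycle; a cover without it must contain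
  the whole rim.\<close>

lemma card_vertex_cover:
  assumes "vertex_cover E D" "4 \<le> m"
  shows "(m + 1) div 2 + 1 \<le> card D"
proof (cases "h \<in> D")
  case True
  have "(m + 1) div 2 \<le> card (D \<inter> set p)"
    using vertex_cover_card_cycle[OF assms(1) distinct_rim] edges by auto
  moreover have "card (insert h (D \<inter> set p)) \<le> card D"
    using True by (intro card_mono) auto
  ultimately show ?thesis
    using hub by simp
next
  case False
  then have "set p \<subseteq> D"
    using assms(1) spoke unfolding vertex_cover_def by fastforce
  then have "card (set p) \<le> card D"
    by (intro card_mono) auto
  then show ?thesis
    using assms(2) distinct_rim by (simp add: distinct_card)
qed

section \<open>Hub value and rim sum of an optimal solution\<close>

lemma rim_sum_ge:
  assumes "feasible (RELP E r s) x"
  shows "(\<Sum>v\<in>set p. x $ v) \<ge> real ((m + 1) div 2)"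
proof (cases "even m")
  case True
  have "2 * (\<Sum>v\<in>set p. x $ v) \<ge> m"
    by (rule cycle_sum_ge_half[OF distinct_rim]) (use feasible_edge[OF assms] edges in auto)
  then show ?thesis
    using True by (auto elim!: evenE)
next
  case False
  then obtain t where t: "m = 2 * t + 1"
    by (auto elim: oddE)
  \<comment> \<open>Adding edge constraints would give only \<open>m / 2\<close>; the rim is itself
    an odd cycle, and its constraint supplies the missing half.\<close>
  then have "p \<in> odd_cycles E"
    using distinct_rim length_rim edges by (auto simp: odd_cycles_def cycle_in_def)
  then show ?thesis
    using assms t unfolding feasible_RELP_iff by fastforce
qed

text \<open>The rim is listed so that the alternating cover contains exactly one of \<open>i\<close>
  and \<open>j\<close>, which bounds the objective by the size of that cover. As
  \<open>rim_sum_ge\<close> bounds the rim from below, \<open>x $ h \<ge> 1\<close> suffices for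
  both equalities.\<close>

lemma optimal_hub_and_rim:
  assumes opt: "optimal_solution (RELP E i j) x" and "4 \<le> m"
    and ij: "{i, j} = {p ! 0, p ! 1} \<or> {i, j} = {h, p ! 1}"
  shows "x $ h = 1 \<and> (\<Sum>v\<in>set p. x $ v) = real ((m + 1) div 2)"
proof -
  define f where "f k = x $ (p ! k)" for k
  have feas: "feasible (RELP E i j) x"
    using opt by (simp add: optimal_solution_def)
  have eq: "x $ i + x $ j = 1" and nonneg: "\<And>v. x $ v \<ge> 0"
    using feas by (auto simp: feasible_RELP_iff)
  have "p ! 0 \<in> alternating_cover" "p ! 1 \<notin> alternating_cover"
    using nth_in_alternating_cover[of 0] nth_in_alternating_cover[of 1] \<open>4 \<le> m\<close> by auto
  then have "i \<in> alternating_cover \<longleftrightarrow> j \<notin> alternating_cover"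
    using ij hub_in_alternating_cover by (auto simp: doubleton_eq_iff)
  then have "(\<Sum>v\<in>UNIV. x $ v) \<le> real ((m + 1) div 2 + 1)"
    using optimal_le_card_vertex_cover[OF opt vertex_cover_alternating] card_alternating_cover
    by simp
  then have upper: "x $ h + (\<Sum>v\<in>set p. x $ v) \<le> real ((m + 1) div 2) + 1"
    by (simp add: sum_vertices)
  have lower: "(\<Sum>v\<in>set p. x $ v) \<ge> real ((m + 1) div 2)"
    by (rule rim_sum_ge[OF feas])
  have sum_f: "(\<Sum>v\<in>set p. x $ v) = (\<Sum>k<m. f k)"
    using distinct_rim by (simp add: sum_set_conv_nth f_def)
  have edge: "f k + f (Suc k) \<ge> 1" if "Suc k < m" for k
    using feasible_edge[OF feas rim_edge_Suc[OF that]] by (simp add: f_def)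
  have tri: "x $ h + f k + f (Suc k) \<ge> 2" if "Suc k < m" for k
    using wheel_triangle[OF feas that] by (simp add: f_def)
  have spk: "x $ h + f k \<ge> 1" if "k < m" for k
    using feasible_edge[OF feas spoke, of "p ! k"] that by (simp add: f_def)
  have "x $ h \<ge> 1"
    using ij
  proof
    assume "{i, j} = {p ! 0, p ! 1}"
    then have "f 0 + f 1 = 1"
      using eq by (auto simp: f_def doubleton_eq_iff)
    then show ?thesis
      using tri[of 0] \<open>4 \<le> m\<close> by simp
  next
    assume "{i, j} = {h, p ! 1}"
    then have h1: "x $ h + f 1 = 1"
      using eq by (auto simp: f_def doubleton_eq_iff)
    \<comment> \<open>The spoke to \<open>p ! 1\<close> has sum exactly 1, so the triangles on its
      two sides force their third vertices up to 1.\<close>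
    have f0: "f 0 \<ge> 1" and f2: "f 2 \<ge> 1"
      using tri[of 0] tri[of 1] h1 \<open>4 \<le> m\<close> by (auto simp: numeral_2_eq_2)
    \<comment> \<open>The parity of \<open>b\<close> is that of \<open>m\<close>, so the indices
      from \<open>b\<close> on split into \<open>t\<close> adjacent pairs, each of sum at least 1.
      Beyond indices 0, 1 and 2 this leaves index 3 for an even rim, indices 3 and 4 for an odd
      one.\<close>
    define b where "b = (if even m then 4 else 5 :: nat)"
    define t where "t = (m - b) div 2"
    have m: "m = b + 2 * t"
      using \<open>4 \<le> m\<close> by (cases "even m") (auto simp: b_def t_def elim!: evenE oddE)
    have "(\<Sum>l=b..<m. f l) \<ge> t"
      unfolding m by (rule sum_consecutive_ge) (use edge m in auto)
    moreover have "(\<Sum>k<m. f k) = (\<Sum>k<b. f k) + (\<Sum>l=b..<m. f l)"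
      using sum.atLeastLessThan_concat[of 0 b m f] m by (simp add: atLeast0LessThan)
    ultimately have small: "x $ h + (\<Sum>k<b. f k) \<le> real ((m + 1) div 2) + 1 - t"
      using upper sum_f by linarith
    show ?thesis
    proof (cases "even m")
      case True
      then have b: "b = 4"
        by (simp add: b_def)
      moreover have "real ((m + 1) div 2) = t + 2"
        unfolding m b by simp
      \<comment> \<open>The hub and indices 0, 1 and 2 use up the remaining budget of 3. The spoke
        to \<open>p ! 3\<close> then forces the hub value.\<close>
      ultimately have "f 3 \<le> 0"
        using small h1 f0 f2 by (simp add: eval_nat_numeral)
      then show ?thesis
        using spk[of 3] \<open>4 \<le> m\<close> by simp
    next
      case False
      then have b: "b = 5"
        by (simp add: b_def)
      moreover have "real ((m + 1) div 2) = t + 3"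
        unfolding m b by simp
      \<comment> \<open>Here the budget is 4, of which 3 is used; the triangle over indices 3 and 4
        forces the hub value.\<close>
      ultimately have "f 3 + f 4 \<le> 1"
        using small h1 f0 f2 by (simp add: eval_nat_numeral)
      then show ?thesis
        using tri[of 3] m b by simp
    qed
  qed
  then show ?thesis
    using upper lower by linarith
qed

text \<open>
  The total slack of the rim edge constraints is 0 or 1, depending on the parity of the rim. A rim
  edge with slack must not survive the rounding, hence it is moved to the wrap-around position,
  where the alternating cover of an odd rim contains both endpoints.
\<close>

lemma alternating_positive:
  assumes feas: "feasible (RELP E r s) x"
    and rim: "(\<Sum>v\<in>set p. x $ v) = real ((m + 1) div 2)"
    and start: "even m \<Longrightarrow> x $ (p ! 0) > 0" "odd m \<Longrightarrow> x $ (p ! (m - 1)) + x $ (p ! 0) > 1"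
    and k: "k < m" "even k"
  shows "x $ (p ! k) > 0"
proof -
  define f where "f k = x $ (p ! k)" for k
  define e where "e l = f l + f (Suc l) - 1" for l
  obtain n where n: "m = Suc n"
    using length_rim by (cases m) auto
  have edge: "f l + f (Suc l) \<ge> 1" if "l < n" for l
    using feasible_edge[OF feas rim_edge_Suc] that n by (simp add: f_def)
  have last: "f n + f 0 \<ge> 1"
    using feasible_edge[OF feas rim_edge[of n]] n by (simp add: f_def)
  have e: "e l \<ge> 0" if "l < n" for l
    using edge[OF that] by (simp add: e_def)
  have "(\<Sum>l<n. f l + f (Suc l)) + (f n + f 0) = 2 * real ((m + 1) div 2)"
    using sum_over_cycle_edges[OF distinct_rim, of "\<lambda>v. x $ v"] rim n by (simp add: f_def)
  then have total: "(\<Sum>l<n. e l) + (f n + f 0 - 1) = 2 * real ((m + 1) div 2) - m"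
    by (simp add: e_def sum_subtractf n)
  have k': "k \<le> n"
    using k n by simp
  have split: "(\<Sum>l<n. e l) = (\<Sum>l<k. e l) + (\<Sum>l=k..<n. e l)"
    using sum.atLeastLessThan_concat[of 0 k n e] k' by (simp add: atLeast0LessThan)
  have tail: "(\<Sum>l=k..<n. e l) \<ge> 0"
    by (rule sum_nonneg) (use e in auto)
  obtain t where t: "k = 2 * t"
    using k(2) by (elim evenE)
  have before: "f 0 \<le> f k + (\<Sum>l<k. e l)"
    using alternating_bound[of 0 t f] edge k' by (simp add: t e_def atLeast0LessThan abs_le_iff)
  have "f k > 0"
  proof (cases "even m")
    case True
    \<comment> \<open>The total slack is 0, so the slack along the path vanishes and
      \<open>before\<close> reduces to \<open>f 0 \<le> f k\<close>.\<close>
    then have "2 * real ((m + 1) div 2) = m"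
      by (auto elim!: evenE)
    then show ?thesis
      using total split tail before last start(1)[OF True] by (simp add: f_def)
  next
    case False
    then have "even (n - k)"
      using n k by simp
    then obtain u where u: "n - k = 2 * u" ..
    have nk: "k + 2 * u = n"
      using u k' by simp
    \<comment> \<open>The total slack is 1, so the path edges carry 2 - (f 0 + f n) of it. Adding
      \<open>before\<close> and \<open>after\<close> gives 2 f k >= 2 (f 0 + f n - 1), which is
      positive by the choice of start.\<close>
    have after: "f n \<le> f k + (\<Sum>l=k..<n. e l)"
      using alternating_bound[of k u f] edge unfolding nk by (simp add: e_def abs_le_iff)
    have "2 * real ((m + 1) div 2) = m + 1"
      using False by (auto elim!: oddE)
    then show ?thesis
      using total split before after start(2)[OF False] n by (simp add: f_def)
  qed
  then show ?thesis
    by (simp add: f_def)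
qed

text \<open>The excluded edge, the wrap-around edge of an odd rim, joins the even indices
  \<open>m - 1\<close> and 0.\<close>

lemma alternating_rim_edge:
  assumes "k < m" "Suc k < m \<or> even m"
  shows "of_bool (p ! k \<in> alternating_cover) + of_bool (p ! (Suc k mod m) \<in> alternating_cover) = (1::real)"
proof (cases "Suc k < m")
  case True
  then show ?thesis
    using nth_in_alternating_cover[of k] nth_in_alternating_cover[of "Suc k"] by simp
next
  case False
  then have "Suc k = m" and "even m"
    using assms by auto
  then have k: "Suc k mod m = 0" "odd k"
    by (metis mod_self, metis even_Suc)
  then have "p ! k \<notin> alternating_cover" "p ! 0 \<in> alternating_cover"
    using nth_in_alternating_cover[of k] nth_in_alternating_cover[of 0] k assms(1) by simp_all
  then show ?thesis
    unfolding k(1) by simp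
qed

text \<open>Such a cycle uses rim edges only. Each contributes 1 to the doubled sum, except that the
  wrap-around edge may contribute 2; it occurs at most once, so the sum is at most
  \<open>t + 1\<close>. The cover property gives the reverse bound. Counting avoids showing that the
  cycle is the whole rim.\<close>

lemma alternating_rim_cycle:
  assumes w: "w \<in> odd_cycles E" "length w = 2 * t + 1" and "h \<notin> set w"
  shows "(\<Sum>v\<in>set w. of_bool (v \<in> alternating_cover)) = real t + 1"
proof -
  define y :: "'n \<Rightarrow> real" where "y v = of_bool (v \<in> alternating_cover)" for v
  define bad where "bad = {p ! (m - 1), p ! 0}"
  have cyc: "distinct w" "3 \<le> length w" "cycle_edges w \<subseteq> E"
    using w(1) by (auto simp: odd_cycles_def cycle_in_def)
  define ed where "ed k = {w ! k, w ! (Suc k mod length w)}" for k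
  have bound: "y (w ! k) + y (w ! (Suc k mod length w)) \<le> 1 + of_bool (ed k = bad)"
    if k: "k < length w" for k
  proof -
    have "ed k \<in> E"
      using cyc(3) k by (auto simp: cycle_edges_def ed_def)
    moreover have "h \<notin> ed k"
      using assms(3) k cyc(2) by (metis ed_def insertE singletonD nth_mem mod_less_divisor
          gr_implies_not0 not_gr_zero)
    ultimately obtain l where l: "l < m" "ed k = {p ! l, p ! (Suc l mod m)}"
      unfolding ed_def by (elim edge_cases) auto
    show ?thesis
    proof (cases "Suc l < m")
      case True
      then have "y (p ! l) + y (p ! (Suc l mod m)) = 1"
        using alternating_rim_edge[OF l(1)] by (simp add: y_def)
      then show ?thesis
        using l(2) by (auto simp: ed_def doubleton_eq_iff)
    next
      case False
      then have "Suc l = m"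
        using l(1) by simp
      then have "l = m - 1" "Suc l mod m = 0"
        by auto
      then have "ed k = bad"
        using l(2) by (simp add: bad_def)
      then show ?thesis
        by (simp add: y_def)
    qed
  qed
  have "card {k. k < length w \<and> ed k = bad} \<le> 1"
    using cycle_edge_index_unique[OF cyc(1,2)]
    by (auto simp: card_le_Suc0_iff_eq ed_def)
  moreover have "(\<Sum>k<length w. of_bool (ed k = bad)) = real (card {k. k < length w \<and> ed k = bad})"
    by (simp add: of_bool_def sum.If_cases Int_def)
  moreover have "2 * (\<Sum>v\<in>set w. y v) \<le> (\<Sum>k<length w. 1 + of_bool (ed k = bad))"
    unfolding sum_over_cycle_edges[OF cyc(1), symmetric] by (rule sum_mono) (use bound in simp)
  ultimately have "(\<Sum>v\<in>set w. y v) \<le> real t + 1"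
    using w(2) by (simp add: sum.distrib)
  moreover have "(\<Sum>v\<in>set w. y v) = real (card (alternating_cover \<inter> set w))"
    by (simp add: y_def of_bool_def sum.If_cases Int_commute Int_def)
  moreover have "t + 1 \<le> card (alternating_cover \<inter> set w)"
    using vertex_cover_card_cycle[OF vertex_cover_alternating cyc(1,3)] w(2) by simp
  ultimately show ?thesis
    by (simp add: y_def)
qed

text \<open>Every constraint active at \<open>x\<close> is tight for the cover. Zeros are handled by
  \<open>alternating_positive\<close>, and a tight spoke ends in a zero because the hub has value 1.
  The one rim edge that can fail has slack at \<open>x\<close> by \<open>start\<close>. Cycles
  through the hub transfer from edges, and odd cycles avoiding it are tight for the cover
  anyway.\<close>

lemma alternating_solution:
  assumes bfs: "basic_feasible_solution (RELP E r s) x" and rs: "{r, s} \<in> E"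
    and h: "x $ h = 1"
    and rim: "(\<Sum>v\<in>set p. x $ v) = real ((m + 1) div 2)"
    and start: "even m \<Longrightarrow> x $ (p ! 0) > 0" "odd m \<Longrightarrow> x $ (p ! (m - 1)) + x $ (p ! 0) > 1"
  shows "x = (\<chi> v. of_bool (v \<in> alternating_cover))"
proof -
  define y :: "real ^ 'n" where "y = (\<chi> v. of_bool (v \<in> alternating_cover))"
  have y: "y $ v = of_bool (v \<in> alternating_cover)" for v
    by (simp add: y_def)
  have feas: "feasible (RELP E r s) x"
    using bfs by (simp add: basic_feasible_solution_def)
  have zero: "y $ v = 0" if "x $ v = 0" for v
  proof (rule ccontr)
    assume "y $ v \<noteq> 0"
    then have "v \<in> alternating_cover" "v \<noteq> h"
      using h that by (auto simp: y)
    then obtain k where "v = p ! k" "k < m" "even k"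
      by (auto simp: alternating_cover_def)
    then show False
      using alternating_positive[OF feas rim start, of k] that by simp
  qed
  have edge: "y $ u + y $ v = 1" if uv: "{u, v} \<in> E" "x $ u + x $ v = 1" for u v
    using uv(1)
  proof (cases rule: edge_cases)
    case (rim k)
    have "x $ (p ! k) + x $ (p ! (Suc k mod m)) = 1"
      using rim(2) uv(2) by (auto simp: doubleton_eq_iff)
    moreover have "k = m - 1" "Suc k mod m = 0" if "\<not> Suc k < m"
    proof -
      have "Suc k = m"
        using that rim(1) by simp
      then show "k = m - 1" "Suc k mod m = 0"
        by auto
    qed
    ultimately have "Suc k < m \<or> even m"
      using start(2) by fastforce
    then have "y $ (p ! k) + y $ (p ! (Suc k mod m)) = 1"
      using alternating_rim_edge[OF rim(1)] by (simp add: y)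
    then show ?thesis
      using rim(2) by (auto simp: doubleton_eq_iff)
  next
    case (spoke w)
    then have "x $ w = 0"
      using uv(2) h by (auto simp: doubleton_eq_iff)
    then show ?thesis
      using zero[of w] spoke(2) hub_in_alternating_cover y[of h] by (auto simp: doubleton_eq_iff)
  qed
  have "y = x"
  proof (rule RELP_basic_feasible_solution_unique[OF bfs rs edge _ zero])
    fix w t
    assume w: "w \<in> odd_cycles E" "length w = 2 * t + 1" "(\<Sum>v\<in>set w. x $ v) = real t + 1"
    show "(\<Sum>v\<in>set w. y $ v) = real t + 1"
    proof (cases "h \<in> set w")
      case True
      show ?thesis
        by (rule odd_cycle_tight_transfer[OF w(1,2) True h _ feasible_edge[OF feas] edge w(3)])
          (simp_all add: y hub_in_alternating_cover)
    next
      case False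
      then show ?thesis
        using alternating_rim_cycle[OF w(1,2)] by (simp add: y)
    qed
  qed
  then show ?thesis
    by (simp add: y_def)
qed

section \<open>Choosing where the rim starts\<close>

lemma rotation_to_start:
  assumes feas: "feasible (RELP E r s) x"
    and rim: "(\<Sum>v\<in>set p. x $ v) = real ((m + 1) div 2)"
  shows "\<exists>k. (even m \<longrightarrow> x $ (rotate k p ! 0) > 0) \<and>
    (odd m \<longrightarrow> x $ (rotate k p ! (m - 1)) + x $ (rotate k p ! 0) > 1)"
proof (cases "even m")
  case True
  have "(\<Sum>v\<in>set p. x $ v) > 0"
    using rim length_rim by simp
  then obtain v where "v \<in> set p" "x $ v > 0"
    by (meson not_le sum_nonpos)
  then obtain k where "k < m" "x $ (p ! k) > 0"
    by (auto simp: in_set_conv_nth)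
  then have "x $ (rotate k p ! 0) > 0"
    by (subst nth_rotate) auto
  then show ?thesis
    using True by blast
next
  case False
  \<comment> \<open>The rim edge sums add up to \<open>m + 1\<close> over \<open>m\<close> edges, so
    one of them exceeds 1.\<close>
  have "\<exists>k<m. x $ (p ! k) + x $ (p ! (Suc k mod m)) > 1"
  proof (rule ccontr)
    assume "\<not> ?thesis"
    then have "(\<Sum>k<m. x $ (p ! k) + x $ (p ! (Suc k mod m))) \<le> (\<Sum>k<m. 1)"
      by (intro sum_mono) auto
    then have "2 * real ((m + 1) div 2) \<le> m"
      using sum_over_cycle_edges[OF distinct_rim, of "\<lambda>v. x $ v"] rim by simp
    then show False
      using False by (auto elim!: oddE)
  qed
  then obtain k where k: "k < m" "x $ (p ! k) + x $ (p ! (Suc k mod m)) > 1"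
    by blast
  \<comment> \<open>Rotating by \<open>Suc k\<close> puts the slack edge at the wrap-around
    position, with \<open>p ! k\<close> last and its successor first.\<close>
  have "rotate (Suc k) p ! 0 = p ! (Suc k mod m)"
    using k(1) by (subst nth_rotate) auto
  moreover have "rotate (Suc k) p ! (m - 1) = p ! ((k + m) mod m)"
    using k(1) by (subst nth_rotate) auto
  ultimately show ?thesis
    using k False by (intro exI[of _ "Suc k"]) (simp del: rotate_Suc)
qed

lemma integral_solution:
  assumes bfs: "basic_feasible_solution (RELP E r s) x" and rs: "{r, s} \<in> E"
    and h: "x $ h = 1"
    and rim: "(\<Sum>v\<in>set p. x $ v) = real ((m + 1) div 2)"
  shows "x $ v \<in> {0, 1}"
proof -
  have "feasible (RELP E r s) x"
    using bfs by (simp add: basic_feasible_solution_def)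
  from rotation_to_start[OF this rim] obtain k where k: "even m \<Longrightarrow> x $ (rotate k p ! 0) > 0"
    "odd m \<Longrightarrow> x $ (rotate k p ! (m - 1)) + x $ (rotate k p ! 0) > 1"
    by blast
  interpret rot: wheel h "rotate k p" E
    by (rule wheel_rotate)
  have "x = (\<chi> v. of_bool (v \<in> rot.alternating_cover))"
    by (rule rot.alternating_solution[OF bfs rs h]) (use rim k in simp_all)
  then have "x $ v = of_bool (v \<in> rot.alternating_cover)"
    by (metis vec_lambda_beta)
  then show ?thesis
    by simp
qed

lemma rotation_to_edge:
  assumes "{i, j} \<in> E"
  shows "\<exists>k. {i, j} = {rotate k p ! 0, rotate k p ! 1} \<or> {i, j} = {h, rotate k p ! 1}"
  using assms
proof (cases rule: edge_cases)
  case (rim k)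
  have "rotate k p ! 0 = p ! k" "rotate k p ! 1 = p ! (Suc k mod m)"
    using rim(1) length_rim nth_rotate[of 0 p k] nth_rotate[of 1 p k] by auto
  then show ?thesis
    using rim(2) by metis
next
  case (spoke w)
  then obtain k where k: "k < m" "w = p ! k"
    by (auto simp: in_set_conv_nth)
  \<comment> \<open>Adding \<open>m\<close> keeps the shift by \<open>k - 1\<close> meaningful for
    \<open>k = 0\<close>.\<close>
  then have "rotate (k + m - 1) p ! 1 = w"
    using length_rim by (subst nth_rotate) auto
  then show ?thesis
    using spoke(2) by metis
qed

text \<open>Two separate rotations are involved: one adapted to \<open>{i, j}\<close> gives the hub
  value and rim sum, and one adapted to \<open>x\<close>, inside \<open>integral_solution\<close>,
  gives the rounding. Both quantities are independent of where the rim starts.\<close>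

lemma wheel_case:
  assumes "4 \<le> m" and ij: "{i, j} \<in> E"
    and bfs: "basic_feasible_solution (RELP E i j) x" and opt: "optimal_solution (RELP E i j) x"
  shows "(\<forall>k. x $ k \<in> {0, 1}) \<and> minimum_vertex_cover E {k. x $ k = 1}"
proof -
  have feas: "feasible (RELP E i j) x"
    using opt by (simp add: optimal_solution_def)
  from rotation_to_edge[OF ij] obtain k where
    k: "{i, j} = {rotate k p ! 0, rotate k p ! 1} \<or> {i, j} = {h, rotate k p ! 1}" ..
  interpret rot: wheel h "rotate k p" E
    by (rule wheel_rotate)
  have h: "x $ h = 1" and rim: "(\<Sum>v\<in>set p. x $ v) = real ((m + 1) div 2)"
    using rot.optimal_hub_and_rim[OF opt _ k] \<open>4 \<le> m\<close> by simp_all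
  have int: "x $ k \<in> {0, 1}" for k
    by (rule integral_solution[OF bfs ij h rim])
  have "minimum_vertex_cover E {k. x $ k = 1}"
    using feas int edge_pair
  proof (rule integral_feasible_minimum)
    show "(\<Sum>v\<in>UNIV. x $ v) \<le> card D" if "vertex_cover E D" for D
      using card_vertex_cover[OF that \<open>4 \<le> m\<close>] by (simp add: sum_vertices h rim)
  qed
  then show ?thesis
    using int by blast
qed

text \<open>The wheel over a triangle is the complete graph on four vertices, so the wheels left
  over have \<open>4 \<le> m\<close>.\<close>

lemma complete_graph_if_length_3:
  assumes "m = 3"
  shows "complete_graph E"
proof -
  obtain a b c where p: "p = [a, b, c]"
    using assms by (auto simp: numeral_3_eq_3 length_Suc_conv)
  have E: "E = {{a, b}, {b, c}, {c, a}, {h, a}, {h, b}, {h, c}}"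
    by (auto simp: edges p cycle_edges_conv_image lessThan_Suc numeral_2_eq_2)
  have V: "v \<in> insert h (set p)" for v
    using vertices by blast
  have ne: "a \<noteq> b" "b \<noteq> c" "a \<noteq> c" "h \<noteq> a" "h \<noteq> b" "h \<noteq> c"
    using distinct_rim hub p by auto
  have pair: "{u, v} \<in> {{u, v} | u v. u \<noteq> v}" if "u \<noteq> v" for u v :: 'n
    using that by blast
  have sub: "E \<subseteq> {{u, v} | u v. u \<noteq> v}"
    unfolding E insert_subset using ne by (intro conjI pair empty_subsetI) simp_all
  have mem: "{a, b} \<in> E" "{b, a} \<in> E" "{b, c} \<in> E" "{c, b} \<in> E" "{c, a} \<in> E" "{a, c} \<in> E"
      "{h, a} \<in> E" "{a, h} \<in> E" "{h, b} \<in> E" "{b, h} \<in> E" "{h, c} \<in> E" "{c, h} \<in> E"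
    by (simp_all add: E doubleton_eq_iff)
  have "{u, v} \<in> E" if "u \<noteq> v" for u v
    using V[of u] V[of v] that mem by (auto simp: p)
  then have "{{u, v} | u v. u \<noteq> v} \<subseteq> E"
    by blast
  with sub show ?thesis
    unfolding complete_graph_def by (rule equalityI)
qed

end

theorem theorem4:
  fixes E :: "'n::finite set set" and i j :: 'n and x0 :: "real ^ 'n"
  assumes "complete_graph E \<or> wheel_graph E"
    and "{i, j} \<in> E"
    and "basic_feasible_solution (RELP E i j) x0"
    and "optimal_solution (RELP E i j) x0"
  shows "(\<forall>k. x0 $ k \<in> {0, 1}) \<and> minimum_vertex_cover E {k. x0 $ k = 1}"
proof (cases "complete_graph E")
  case True
  then show ?thesis
    by (rule complete_graph_case[OF _ assms(2-4)])
next
  case False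
  then obtain h p where "wheel h p E"
    using assms(1) unfolding wheel_graph_def wheel_def by blast
  then interpret wheel h p E .
  have "4 \<le> length p"
    using complete_graph_if_length_3 length_rim False by fastforce
  then show ?thesis
    by (rule wheel_case[OF _ assms(2-4)])
qed

end
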